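(* For every $n\ge 1$, the quadratic algebra $P_n$ is Koszul.
   Context: Fix a ground field $F$; $[m]=\{1,\dots,m\}$ and $[x,y]=xy-yx$. $P_n$ denotes the associative unital $F$-algebra presented by generators $v_1,\dots,v_n,e_{1,2},e_{2,3},\dots,e_{n-1,n}$ and relations: $[v_i,v_j]=0$ for $i,j\in[n]$, $j>i+1$; $[v_i,v_{i+1}]+e_{i,i+1}(v_{i+1}-v_i)=0$ for $i\in[n-1]$; $[e_{i,i+1},e_{j,j+1}]=0$ for $i,j\in[n-1]$, $j>i+1$; $[v_i,e_{j,j+1}]=0$ for $i\in[n]$, $j\in[n-1]$ with $j>i+1$ or $j<i-2$; $[v_i,e_{i+1,i+2}]+e_{i,i+1}e_{i+1,i+2}=0$ for $i\in[n-2]$; $[v_{i+2},e_{i,i+1}]+e_{i+1,i+2}e_{i,i+1}=0$ for $i\in[n-2]$. (This is the algebra associated with the path graph on $n$ vertices.) A quadratic algebra $A=T(V)/(R)$, where $V$ is the span of the generators and $R\subseteq V\otimes V$ is the span of the defining relations, is called Koszul if for every $m$ the collection of $m-1$ subspaces $V^{\otimes (i-1)}\otimes R\otimes V^{\otimes (m-i-1)}$, $1\le i\le m-1$, generates a distributive lattice of subspaces of $V^{\otimes m}$ (under sum and intersection). *)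

theory Defs
  imports Complex_Main
    "HOL-Algebra.QuotRing"
    "HOL-Library.Function_Algebras"
    "HOL-Library.Set_Algebras"
begin

section \<open>The tensor algebra\<close>

text \<open>
  A tensor over the vector space with basis \<open>X\<close> is a finitely supported function assigning a
  coefficient to each word in \<open>X\<close>. Addition and subtraction are the pointwise operations on
  functions; the product of tensors is \<open>f \<star> g\<close> below, \<^emph>\<open>not\<close> the pointwise product that
  \<^theory>\<open>HOL-Library.Function_Algebras\<close> writes as \<open>f * g\<close>.
\<close>

definition supp :: "('x list \<Rightarrow> 'f::zero) \<Rightarrow> 'x list set"
  where "supp f = {w. f w \<noteq> 0}"

definition scale :: "'f::field \<Rightarrow> ('x list \<Rightarrow> 'f) \<Rightarrow> 'x list \<Rightarrow> 'f"
  where "scale c f = (\<lambda>w. c * f w)"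

interpretation tensors: vector_space scale
  by unfold_locales (auto simp: scale_def algebra_simps fun_eq_iff)

definition word :: "'x list \<Rightarrow> 'x list \<Rightarrow> 'f::zero_neq_one"
  where "word u = (\<lambda>w. if w = u then 1 else 0)"

definition tprod :: "('x list \<Rightarrow> 'f::field) \<Rightarrow> ('x list \<Rightarrow> 'f) \<Rightarrow> 'x list \<Rightarrow> 'f"  (infixl \<open>\<star>\<close> 70)
  where "f \<star> g = (\<lambda>w. \<Sum>k\<le>length w. f (take k w) * g (drop k w))"

text \<open>The scalars of the algebra are the multiples of the unit \<open>word []\<close>; see
  \<open>scale_conv_tprod\<close> and \<open>tprod_const\<close>.\<close>

definition tensor_algebra :: "'x set \<Rightarrow> ('x list \<Rightarrow> 'f::field) ring"
  where "tensor_algebra X =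
    \<lparr>carrier = {f. finite (supp f) \<and> supp f \<subseteq> lists X},
     mult = (\<star>), one = word [], zero = 0, add = (+)\<rparr>"

definition tensor_power :: "'x set \<Rightarrow> nat \<Rightarrow> ('x list \<Rightarrow> 'f::field) set"
  where "tensor_power X m = {f \<in> carrier (tensor_algebra X). \<forall>w \<in> supp f. length w = m}"

definition tensor :: "('x list \<Rightarrow> 'f::field) set \<Rightarrow> ('x list \<Rightarrow> 'f) set \<Rightarrow> ('x list \<Rightarrow> 'f) set"
  where "tensor A B = tensors.span {a \<star> b | a b. a \<in> A \<and> b \<in> B}"


section \<open>Quadratic algebras and Koszulness\<close>

definition quadratic_algebra ::
    "'x set \<Rightarrow> ('x list \<Rightarrow> 'f::field) set \<Rightarrow> ('x list \<Rightarrow> 'f) set ring"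
  where "quadratic_algebra X S = tensor_algebra X Quot (genideal (tensor_algebra X) S)"

text \<open>The sum of two subspaces is their elementwise sum from \<^theory>\<open>HOL-Library.Set_Algebras\<close>.\<close>

inductive_set subspace_lattice :: "'a::plus set set \<Rightarrow> 'a set set" for G :: "'a set set" where
  base: "A \<in> G \<Longrightarrow> A \<in> subspace_lattice G"
| sum: "A \<in> subspace_lattice G \<Longrightarrow> B \<in> subspace_lattice G \<Longrightarrow> A + B \<in> subspace_lattice G"
| inter: "A \<in> subspace_lattice G \<Longrightarrow> B \<in> subspace_lattice G \<Longrightarrow> A \<inter> B \<in> subspace_lattice G"

definition generates_distributive_lattice :: "'a::plus set set \<Rightarrow> bool"
  where "generates_distributive_lattice G \<longleftrightarrow>
    (\<forall>A \<in> subspace_lattice G. \<forall>B \<in> subspace_lattice G. \<forall>C \<in> subspace_lattice G.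
       A \<inter> (B + C) = (A \<inter> B) + (A \<inter> C))"

definition relation_subspaces ::
    "'x set \<Rightarrow> ('x list \<Rightarrow> 'f::field) set \<Rightarrow> nat \<Rightarrow> ('x list \<Rightarrow> 'f) set set"
  where "relation_subspaces X R m =
    {tensor (tensor (tensor_power X (i - 1)) R) (tensor_power X (m - i - 1)) | i. i \<in> {1..m - 1}}"

text \<open>
  The data \<open>X\<close> and \<open>span S\<close> are determined by the quotient ring
  (\<open>quadratic_algebra_determines_data\<close>), so the existential quantifier offers no choice:
  see \<open>koszul_quadratic_algebra_iff\<close>.
\<close>

definition koszul :: "('x list \<Rightarrow> 'f::field) set ring \<Rightarrow> bool"
  where "koszul A \<longleftrightarrow>
    (\<exists>X S. S \<subseteq> tensor_power X 2 \<and> A = quadratic_algebra X S \<and>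
       (\<forall>m. generates_distributive_lattice (relation_subspaces X (tensors.span S) m)))"


section \<open>The algebra of the path graph\<close>

text \<open>\<open>Edge i\<close> stands for the edge between \<open>i\<close> and \<open>i + 1\<close>.\<close>

datatype path_gen = Vertex nat | Edge nat

definition path_gens :: "nat \<Rightarrow> path_gen set"
  where "path_gens n = Vertex ` {1..n} \<union> Edge ` {1..n - 1}"

definition vert :: "nat \<Rightarrow> path_gen list \<Rightarrow> 'f::field"
  where "vert i = word [Vertex i]"

definition edge :: "nat \<Rightarrow> path_gen list \<Rightarrow> 'f::field"
  where "edge i = word [Edge i]"

definition comm :: "('x list \<Rightarrow> 'f::field) \<Rightarrow> ('x list \<Rightarrow> 'f) \<Rightarrow> 'x list \<Rightarrow> 'f"
  where "comm f g = f \<star> g - g \<star> f"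

definition path_relations :: "nat \<Rightarrow> (path_gen list \<Rightarrow> 'f::field) set"
  where "path_relations n =
      {comm (vert i) (vert j) | i j. i \<in> {1..n} \<and> j \<in> {1..n} \<and> j > i + 1}
    \<union> {comm (vert i) (vert (i + 1)) + edge i \<star> (vert (i + 1) - vert i) | i. i \<in> {1..n - 1}}
    \<union> {comm (edge i) (edge j) | i j. i \<in> {1..n - 1} \<and> j \<in> {1..n - 1} \<and> j > i + 1}
    \<union> {comm (vert i) (edge j) | i j. i \<in> {1..n} \<and> j \<in> {1..n - 1} \<and> (j > i + 1 \<or> j + 2 < i)}
    \<union> {comm (vert i) (edge (i + 1)) + edge i \<star> edge (i + 1) | i. i \<in> {1..n - 2}}
    \<union> {comm (vert (i + 2)) (edge i) + edge (i + 1) \<star> edge i | i. i \<in> {1..n - 2}}"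

definition path_algebra :: "nat \<Rightarrow> (path_gen list \<Rightarrow> 'f::field) set ring"
  where "path_algebra n = quadratic_algebra (path_gens n) (path_relations n)"


section \<open>Basic facts\<close>

lemma tensor_algebra_simps [simp]:
  "mult (tensor_algebra X) = (\<star>)" "one (tensor_algebra X) = word []"
  "zero (tensor_algebra X) = 0" "add (tensor_algebra X) = (+)"
  by (simp_all add: tensor_algebra_def)

lemma in_carrier_tensor_algebra:
  "f \<in> carrier (tensor_algebra X) \<longleftrightarrow> finite (supp f) \<and> supp f \<subseteq> lists X"
  by (simp add: tensor_algebra_def)

lemma tprod_distrib_left: "f \<star> (g + h) = f \<star> g + f \<star> h"
  by (simp add: tprod_def fun_eq_iff algebra_simps sum.distrib)

lemma tprod_distrib_right: "(f + g) \<star> h = f \<star> h + g \<star> h"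
  by (simp add: tprod_def fun_eq_iff algebra_simps sum.distrib)

lemma tprod_const: "f \<star> scale c (word []) = scale c f"
proof
  fix w
  have "(f \<star> scale c (word [])) w = (\<Sum>k\<le>length w. if k = length w then c * f w else 0)"
    unfolding tprod_def by (intro sum.cong) (auto simp: scale_def word_def)
  then show "(f \<star> scale c (word [])) w = scale c f w"
    by (simp add: scale_def)
qed

lemma scale_conv_tprod: "scale c (word []) \<star> f = scale c f"
proof
  fix w
  have "(scale c (word []) \<star> f) w = (\<Sum>k\<le>length w. if k = 0 then c * f w else 0)"
    unfolding tprod_def by (intro sum.cong) (auto simp: scale_def word_def)
  then show "(scale c (word []) \<star> f) w = scale c f w"
    by (simp add: scale_def)
qed

lemma scale_one: "scale 1 f = f"
  by (simp add: scale_def)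

lemma tprod_assoc: "(f \<star> g) \<star> h = f \<star> (g \<star> h)"
proof
  fix w :: "'a list"
  let ?n = "length w"
  let ?t = "\<lambda>(k, j). f (take j w) * g (take (k - j) (drop j w)) * h (drop k w)"
  have "((f \<star> g) \<star> h) w = (\<Sum>k\<le>?n. \<Sum>j\<le>k. ?t (k, j))"
    unfolding tprod_def
    by (intro sum.cong refl)
      (auto simp: sum_distrib_right take_drop min_def intro!: sum.cong)
  also have "\<dots> = (\<Sum>p\<in>(SIGMA k:{..?n}. {..k}). ?t p)"
    by (subst sum.Sigma) auto
  also have "\<dots> = (\<Sum>(j, i)\<in>(SIGMA j:{..?n}. {..?n - j}). ?t (i + j, j))"
    by (rule sum.reindex_bij_witness[where i = "\<lambda>(j, i). (i + j, j)" and j = "\<lambda>(k, j). (j, k - j)"])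
      auto
  also have "\<dots> = (\<Sum>j\<le>?n. \<Sum>i\<le>?n - j. ?t (i + j, j))"
    by (subst sum.Sigma) auto
  also have "\<dots> = (f \<star> (g \<star> h)) w"
    unfolding tprod_def
    by (intro sum.cong refl) (auto simp: sum_distrib_left mult.assoc intro!: sum.cong)
  finally show "((f \<star> g) \<star> h) w = (f \<star> (g \<star> h)) w" .
qed

lemma supp_tprod: "supp (f \<star> g) \<subseteq> (\<lambda>(a, b). a @ b) ` (supp f \<times> supp g)"
proof
  fix w assume "w \<in> supp (f \<star> g)"
  then have "(\<Sum>k\<le>length w. f (take k w) * g (drop k w)) \<noteq> 0"
    by (simp add: supp_def tprod_def)
  then obtain k where "f (take k w) * g (drop k w) \<noteq> 0"
    by (meson sum.neutral)
  then show "w \<in> (\<lambda>(a, b). a @ b) ` (supp f \<times> supp g)"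
    by (intro image_eqI[of _ _ "(take k w, drop k w)"]) (auto simp: supp_def)
qed

lemma supp_add: "supp (f + g :: _ \<Rightarrow> 'f::field) \<subseteq> supp f \<union> supp g"
  by (auto simp: supp_def)

lemma supp_scale: "supp (scale c f) \<subseteq> supp f"
  by (auto simp: supp_def scale_def)

lemma supp_word: "supp (word u :: _ \<Rightarrow> 'f::zero_neq_one) = {u}"
  by (auto simp: supp_def word_def)

lemma supp_zero [simp]: "supp 0 = {}"
  by (auto simp: supp_def)

lemma tprod_closed:
  assumes "f \<in> carrier (tensor_algebra X)" "g \<in> carrier (tensor_algebra X)"
  shows "f \<star> g \<in> carrier (tensor_algebra X)"
proof -
  have "finite (supp (f \<star> g))"
    using assms by (intro finite_subset[OF supp_tprod]) (auto simp: in_carrier_tensor_algebra)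
  moreover have "(\<lambda>(a, b). a @ b) ` (supp f \<times> supp g) \<subseteq> lists X"
    using assms by (fastforce simp: in_carrier_tensor_algebra)
  ultimately show ?thesis
    using supp_tprod[of f g] by (auto simp: in_carrier_tensor_algebra)
qed

lemma add_closed:
  assumes "f \<in> carrier (tensor_algebra X)" "g \<in> carrier (tensor_algebra X)"
  shows "f + g \<in> carrier (tensor_algebra X)"
  using assms supp_add[of f g] by (auto simp: in_carrier_tensor_algebra intro: finite_subset)

lemma scale_closed:
  assumes "f \<in> carrier (tensor_algebra X)"
  shows "scale c f \<in> carrier (tensor_algebra X)"
  using assms supp_scale[of c f] by (auto simp: in_carrier_tensor_algebra intro: finite_subset)

lemma unit_closed: "word [] \<in> carrier (tensor_algebra X)"
  by (simp add: in_carrier_tensor_algebra supp_word)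

lemma zero_closed: "0 \<in> carrier (tensor_algebra X)"
  by (simp add: in_carrier_tensor_algebra)

lemma ring_tensor_algebra: "ring (tensor_algebra X :: ('x list \<Rightarrow> 'f::field) ring)"
proof (intro ringI abelian_groupI monoidI)
  fix x assume x: "x \<in> carrier (tensor_algebra X :: ('x list \<Rightarrow> 'f) ring)"
  show "\<exists>y\<in>carrier (tensor_algebra X). y \<oplus>\<^bsub>tensor_algebra X\<^esub> x = \<zero>\<^bsub>tensor_algebra X\<^esub>"
    using scale_closed[OF x, of "- 1"]
    by (intro bexI[of _ "scale (- 1) x"]) (auto simp: scale_def fun_eq_iff)
qed (use tprod_const[of _ 1] scale_conv_tprod[of 1] in
    \<open>auto simp: tprod_closed add_closed tprod_distrib_left tprod_distrib_right tprod_assoc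
      scale_one add.assoc add.commute unit_closed zero_closed\<close>)

lemma path_relations_quadratic: "path_relations n \<subseteq> tensor_power (path_gens n) 2"
proof -
  let ?X = "path_gens n"
  have add: "f + g \<in> tensor_power ?X 2" and diff: "f - g \<in> tensor_power ?X 2"
    if "f \<in> tensor_power ?X 2" "g \<in> tensor_power ?X 2"
    for f g :: "path_gen list \<Rightarrow> 'a"
  proof -
    have s: "supp (f + g) \<subseteq> supp f \<union> supp g" "supp (f - g) \<subseteq> supp f \<union> supp g"
      by (auto simp: supp_def)
    moreover from that have "finite (supp (f + g))" "finite (supp (f - g))"
      using s by (auto simp: tensor_power_def in_carrier_tensor_algebra
          intro: finite_subset[OF _ finite_UnI])
    ultimately show "f + g \<in> tensor_power ?X 2" "f - g \<in> tensor_power ?X 2"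
      using that by (fastforce simp: tensor_power_def in_carrier_tensor_algebra)+
  qed
  have prod: "word [a] \<star> word [b] = (word [a, b] :: path_gen list \<Rightarrow> 'a)" for a b
  proof -
    have "word [a] (take k w) * word [b] (drop k w) =
        (if k = 1 \<and> w = [a, b] then 1 else 0 :: 'a)" if "k \<le> length w" for k w
    proof (cases "take k w = [a] \<and> drop k w = [b]")
      case True
      then have "w = [a] @ [b]" by (metis append_take_drop_id)
      with True show ?thesis
        by (cases k) (auto simp: word_def)
    next
      case False
      then show ?thesis by (auto simp: word_def)
    qed
    then have "(word [a] \<star> word [b]) w =
        (\<Sum>k\<le>length w. if k = 1 then (if w = [a, b] then 1 else 0) else 0 :: 'a)" for w
      unfolding tprod_def by (intro sum.cong) auto
    then show ?thesis
      by (auto simp: fun_eq_iff word_def)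
  qed
  have mem: "word [a] \<star> word [b] \<in> (tensor_power ?X 2 :: (path_gen list \<Rightarrow> 'a) set)"
    if "a \<in> ?X" "b \<in> ?X" for a b
    using that by (simp add: prod tensor_power_def in_carrier_tensor_algebra supp_word)
  have dl: "f \<star> (g - h) = f \<star> g - f \<star> h" for f g h :: "path_gen list \<Rightarrow> 'a"
    by (simp add: tprod_def fun_eq_iff algebra_simps sum_subtractf)
  have gens: "Vertex i \<in> ?X \<longleftrightarrow> 1 \<le> i \<and> i \<le> n" "Edge i \<in> ?X \<longleftrightarrow> 1 \<le> i \<and> i \<le> n - 1" for i
    by (auto simp: path_gens_def)
  show ?thesis
    unfolding path_relations_def comm_def vert_def edge_def dl
    by (auto intro!: add diff mem simp: gens)
qed

lemma subspace_tensor_power: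
  "tensors.subspace (tensor_power X m :: ('x list \<Rightarrow> 'f::field) set)"
  unfolding tensors.subspace_def
proof (intro conjI ballI allI)
  show "0 \<in> tensor_power X m"
    by (simp add: tensor_power_def in_carrier_tensor_algebra)
next
  fix x y :: "'x list \<Rightarrow> 'f" assume "x \<in> tensor_power X m" "y \<in> tensor_power X m"
  then show "x + y \<in> tensor_power X m"
    using supp_add[of x y] add_closed[of x X y] by (auto simp: tensor_power_def)
next
  fix c and x :: "'x list \<Rightarrow> 'f" assume "x \<in> tensor_power X m"
  then show "scale c x \<in> tensor_power X m"
    using supp_scale[of c x] scale_closed[of x X c] by (auto simp: tensor_power_def)
qed

lemma degree_two_part_genideal:
  fixes S :: "('x list \<Rightarrow> 'f::field) set"
  assumes S: "S \<subseteq> tensor_power X 2"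
  shows "genideal (tensor_algebra X) S \<inter> tensor_power X 2 = tensors.span S"
proof (rule antisym)
  let ?T = "tensor_algebra X :: ('x list \<Rightarrow> 'f) ring"
  interpret T: ring ?T by (rule ring_tensor_algebra)
  have ST: "S \<subseteq> carrier ?T" using S by (auto simp: tensor_power_def)
  interpret I: ideal "genideal ?T S" ?T by (rule T.genideal_ideal[OF ST])
  show "tensors.span S \<subseteq> genideal ?T S \<inter> tensor_power X 2"
  proof (rule tensors.span_minimal)
    show "S \<subseteq> genideal ?T S \<inter> tensor_power X 2"
      using S T.genideal_self[OF ST] by blast
    have "scale c x \<in> genideal ?T S" if "x \<in> genideal ?T S" for c x
    proof -
      have "scale c (word []) \<in> carrier ?T"
        using T.one_closed scale_closed by fastforce
      from I.I_l_closed[OF that this] show ?thesis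
        by (simp add: scale_conv_tprod)
    qed
    then have "tensors.subspace (genideal ?T S)"
      using I.zero_closed I.a_closed by (auto simp: tensors.subspace_def)
    then show "tensors.subspace (genideal ?T S \<inter> tensor_power X 2)"
      using subspace_tensor_power by (rule tensors.subspace_inter)
  qed
  define p where "p f = (\<lambda>w. if length w = 2 then f w else 0)" for f :: "'x list \<Rightarrow> 'f"
  define J where "J = {f \<in> carrier ?T. (\<forall>w. length w < 2 \<longrightarrow> f w = 0) \<and> p f \<in> tensors.span S}"
  have p_tensor: "p f = f" if "f \<in> tensor_power X 2" for f
    using that by (auto simp: p_def tensor_power_def supp_def fun_eq_iff)
  have p_add: "p (f + g) = p f + p g" and p_scale: "p (scale c f) = scale c (p f)"
    for f g c by (auto simp: p_def scale_def fun_eq_iff)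
  have low: "(f \<star> g) w = 0" if "length w < 2" "(\<forall>w. length w < 2 \<longrightarrow> f w = 0) \<or> (\<forall>w. length w < 2 \<longrightarrow> g w = 0)"
    for f g :: "'x list \<Rightarrow> 'f" and w
    using that unfolding tprod_def by (intro sum.neutral) auto
  have pl: "p (x \<star> a) = scale (x []) (p a)" if "\<forall>w. length w < 2 \<longrightarrow> a w = 0" for x a
  proof
    fix w
    show "p (x \<star> a) w = scale (x []) (p a) w"
    proof (cases "length w = 2")
      case True
      have "(x \<star> a) w = (\<Sum>k\<le>length w. if k = 0 then x [] * a w else 0)"
        unfolding tprod_def using that True by (intro sum.cong) auto
      then show ?thesis using True by (simp add: p_def scale_def)
    qed (simp add: p_def scale_def)
  qed
  have pr: "p (a \<star> x) = scale (x []) (p a)" if "\<forall>w. length w < 2 \<longrightarrow> a w = 0" for x a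
  proof
    fix w
    show "p (a \<star> x) w = scale (x []) (p a) w"
    proof (cases "length w = 2")
      case True
      have "(a \<star> x) w = (\<Sum>k\<le>length w. if k = length w then x [] * a w else 0)"
        unfolding tprod_def using that True by (intro sum.cong) (auto simp: min_def)
      then show ?thesis using True by (simp add: p_def scale_def)
    qed (simp add: p_def scale_def)
  qed
  have "ideal J ?T"
  proof (rule idealI)
    show "ring ?T" by (rule ring_tensor_algebra)
    have minus: "\<ominus>\<^bsub>?T\<^esub> f = scale (- 1) f" if "f \<in> carrier ?T" for f
      using that scale_closed[OF that, of "- 1"]
      by (intro T.minus_equality) (auto simp: scale_def fun_eq_iff)
    show "subgroup J (add_monoid ?T)"
    proof (rule T.add.subgroupI)
      have "p 0 = 0" by (simp add: p_def fun_eq_iff)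
      then have "0 \<in> J"
        using T.zero_closed tensors.span_zero by (simp add: J_def)
      then show "J \<noteq> {}" by blast
    next
      fix a assume a: "a \<in> J"
      then have "scale (- 1) a \<in> J"
        using scale_closed[of a X "- 1"] tensors.span_scale[of "p a" S "- 1"]
        unfolding J_def mem_Collect_eq p_scale by (auto simp del: tensors.scale_minus_left simp: scale_def)
      then show "\<ominus>\<^bsub>?T\<^esub> a \<in> J" using minus a by (auto simp: J_def)
    next
      fix a b assume "a \<in> J" "b \<in> J"
      then show "a \<oplus>\<^bsub>?T\<^esub> b \<in> J"
        by (auto simp: J_def p_add add_closed intro: tensors.span_add)
    qed (auto simp: J_def)
  next
    fix a x assume "a \<in> J" "x \<in> carrier ?T"
    then show "x \<otimes>\<^bsub>?T\<^esub> a \<in> J" "a \<otimes>\<^bsub>?T\<^esub> x \<in> J"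
      by (auto simp: J_def tprod_closed low pl pr intro: tensors.span_scale)
  qed
  moreover have "S \<subseteq> J"
  proof
    fix s assume s: "s \<in> S"
    with S have "s \<in> tensor_power X 2" by blast
    with s show "s \<in> J"
      by (auto simp: J_def p_tensor tensors.span_base) (auto simp: tensor_power_def supp_def)
  qed
  ultimately have "genideal ?T S \<subseteq> J" by (rule T.genideal_minimal)
  then show "genideal ?T S \<inter> tensor_power X 2 \<subseteq> tensors.span S"
    using p_tensor by (force simp: J_def)
qed

lemma quadratic_algebra_determines_data:
  fixes S S' :: "('x list \<Rightarrow> 'f::field) set"
  assumes S: "S \<subseteq> tensor_power X 2" and S': "S' \<subseteq> tensor_power X' 2"
    and eq: "quadratic_algebra X S = quadratic_algebra X' S'"
  shows "X = X'" and "tensors.span S = tensors.span S'"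
proof -
  let ?T = "\<lambda>X. tensor_algebra X :: ('x list \<Rightarrow> 'f) ring"
  have carr: "\<Union> (carrier (quadratic_algebra X S)) = carrier (?T X)"
    if S: "S \<subseteq> tensor_power X 2" for X and S :: "('x list \<Rightarrow> 'f) set"
  proof -
    interpret T: ring "?T X" by (rule ring_tensor_algebra)
    have "S \<subseteq> carrier (?T X)" using S by (auto simp: tensor_power_def)
    then interpret I: ideal "genideal (?T X) S" "?T X" by (rule T.genideal_ideal)
    show ?thesis
      using I.a_rcosets_part_G by (simp add: quadratic_algebra_def FactRing_def)
  qed
  have "X = {x. word [x] \<in> carrier (?T X)}" for X :: "'x set"
    by (auto simp: in_carrier_tensor_algebra supp_word)
  moreover have "carrier (?T X) = carrier (?T X')"
    using carr[OF S] carr[OF S'] eq by simp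
  ultimately show X: "X = X'" by metis
  have "genideal (?T X) S = genideal (?T X') S'"
    using arg_cong[OF eq, of zero] by (simp add: quadratic_algebra_def FactRing_def)
  then show "tensors.span S = tensors.span S'"
    using degree_two_part_genideal[OF S] degree_two_part_genideal[OF S'] X by simp
qed

lemma koszul_quadratic_algebra_iff:
  assumes "S \<subseteq> tensor_power X 2"
  shows "koszul (quadratic_algebra X S) \<longleftrightarrow>
    (\<forall>m. generates_distributive_lattice (relation_subspaces X (tensors.span S) m))"
  unfolding koszul_def using assms quadratic_algebra_determines_data by metis

end

theory Submission
  imports Defs "HOL-Library.List_Lexorder"
begin

text \<open>
  Let \<open>Vertex i\<close> cover \<open>i\<close> and \<open>Edge i\<close> cover \<open>i\<close> and \<open>i + 1\<close>; call a two-letter word leading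
  if its first letter covers smaller vertices than its second. The quadratic dual of the path algebra
  acts on the span of the sets of generators with disjoint covers: a generator multiplies such a set
  by the generator covering those of its vertices that are still free, up to sign, and by zero if
  there are none. The coefficients of this action on the empty set give, for every word \<open>w\<close> all of
  whose two-letter subwords are leading, a tensor that satisfies the relations at every position and
  has the form \<open>w\<close> plus larger words. Cutting an arbitrary word \<open>w\<close> at its non-leading
  two-letter subwords and multiplying the tensors of the pieces gives a tensor \<open>b w\<close>, again
  \<open>w\<close> plus larger words, that satisfies the relations wherever \<open>w\<close> has a leading subword.
  By triangularity the \<open>b w\<close> form a basis of the tensor power, and a tensor in a relation subspace
  is determined by its coefficients at the words with a leading subword there. So every relation
  subspace is spanned by a part of one common basis, which makes the lattice distributive.
\<close>

section \<open>Distributivity from an adapted basis\<close>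

text \<open>A vector in both spans has a unique representation over \<open>B\<close>, which agrees
  with its representations over \<open>A\<close> and over \<open>A'\<close>; hence its support lies
  in both sets.\<close>

lemma (in vector_space) span_Int_independent:
  assumes B: "independent B" and "A \<subseteq> B" "A' \<subseteq> B"
  shows "span A \<inter> span A' = span (A \<inter> A')"
proof
  show "span A \<inter> span A' \<subseteq> span (A \<inter> A')"
  proof
    fix v assume v: "v \<in> span A \<inter> span A'"
    let ?r = "representation B v"
    have "?r = representation A v" "?r = representation A' v"
      using v assms by (auto intro: representation_extend)
    then have supp: "{b. ?r b \<noteq> 0} \<subseteq> A \<inter> A'"
      using representation_ne_zero by (metis (mono_tags) IntI mem_Collect_eq subsetI)
    have "v \<in> span B" using v span_mono[OF \<open>A \<subseteq> B\<close>] by blast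
    then have "v = (\<Sum>b | ?r b \<noteq> 0. scale (?r b) b)"
      by (simp add: sum_nonzero_representation_eq[OF B])
    also have "\<dots> \<in> span (A \<inter> A')"
      using supp by (intro span_sum span_scale span_base) auto
    finally show "v \<in> span (A \<inter> A')" .
  qed
qed (simp add: span_mono)

lemma span_Un_plus: "tensors.span (A \<union> A') = tensors.span A + tensors.span A'"
  by (auto simp: tensors.span_Un set_plus_def)

text \<open>Forming spans of subsets of \<open>B\<close> turns unions into sums and, by
  independence, intersections into intersections. The whole lattice consists of such spans and
  inherits distributivity from sets.\<close>

lemma generates_distributive_lattice_if_basis:
  fixes B :: "('x list \<Rightarrow> 'f::field) set"
  assumes B: "tensors.independent B"
    and G: "\<And>A. A \<in> G \<Longrightarrow> \<exists>C\<subseteq>B. A = tensors.span C"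
  shows "generates_distributive_lattice G"
proof -
  have spans: "\<exists>C\<subseteq>B. A = tensors.span C" if "A \<in> subspace_lattice G" for A
    using that
  proof induction
    case (sum A A')
    then show ?case by (metis Un_least span_Un_plus)
  next
    case (inter A A')
    then obtain C C' where "C \<subseteq> B" "C' \<subseteq> B" "A = tensors.span C" "A' = tensors.span C'"
      by blast
    then show ?case
      using tensors.span_Int_independent[OF B, of C C'] by (intro exI[of _ "C \<inter> C'"]) auto
  qed (use G in blast)
  show ?thesis
    unfolding generates_distributive_lattice_def
  proof (intro ballI)
    fix P Q R
    assume "P \<in> subspace_lattice G" "Q \<in> subspace_lattice G" "R \<in> subspace_lattice G"
    then obtain P' Q' R' where sub: "P' \<subseteq> B" "Q' \<subseteq> B" "R' \<subseteq> B"
      and eq: "P = tensors.span P'" "Q = tensors.span Q'" "R = tensors.span R'"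
      using spans by meson
    have "P \<inter> (Q + R) = tensors.span (P' \<inter> (Q' \<union> R'))"
      using sub by (simp add: eq tensors.span_Int_independent[OF B] flip: span_Un_plus)
    also have "\<dots> = tensors.span (P' \<inter> Q') + tensors.span (P' \<inter> R')"
      by (simp add: Int_Un_distrib span_Un_plus)
    also have "\<dots> = (P \<inter> Q) + (P \<inter> R)"
      using sub by (simp add: eq tensors.span_Int_independent[OF B])
    finally show "P \<inter> (Q + R) = (P \<inter> Q) + (P \<inter> R)" .
  qed
qed

section \<open>Families of tensors that are unitriangular with respect to a key\<close>

lemma scale_apply: "scale c f w = c * f w"
  by (simp add: scale_def)

lemma sum_fun_apply: "(\<Sum>i\<in>A. f i) w = (\<Sum>i\<in>A. f i w)"
  by (induction A rule: infinite_finite_induct) auto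

context
  fixes b :: "'x list \<Rightarrow> 'x list \<Rightarrow> 'f::field" and key :: "'x list \<Rightarrow> 'k::linorder"
    and W :: "'x list set"
  assumes W: "finite W"
    and diagonal: "\<And>w. w \<in> W \<Longrightarrow> b w w = 1"
    and triangular: "\<And>w w'. w \<in> W \<Longrightarrow> w' \<in> W \<Longrightarrow> b w w' \<noteq> 0 \<Longrightarrow> w' = w \<or> key w < key w'"
begin

text \<open>A vanishing combination is evaluated at a word of minimal key among those whose tensor
  has a nonzero coefficient. By triangularity no other tensor contributes there, so that coefficient
  would be zero.\<close>

lemma triangular_independent: "tensors.independent (b ` W)"
proof
  assume "tensors.dependent (b ` W)"
  then obtain u where u: "\<exists>v\<in>b ` W. u v \<noteq> 0" "(\<Sum>v\<in>b ` W. scale (u v) v) = 0"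
    using W by (subst (asm) tensors.dependent_finite) auto
  let ?N = "{w \<in> W. u (b w) \<noteq> 0}"
  have N: "finite ?N" "?N \<noteq> {}" using W u(1) by auto
  define w where "w = arg_min_on key ?N"
  have min: "\<not> key w' < key w" if "w' \<in> ?N" for w'
    using arg_min_if_finite(2)[OF N, of key] that by (auto simp: w_def)
  have w: "w \<in> W" "u (b w) \<noteq> 0"
    using arg_min_if_finite(1)[OF N, of key] by (auto simp: w_def)
  have "0 = (\<Sum>v\<in>b ` W. scale (u v) v) w" by (simp add: u(2))
  also have "\<dots> = (\<Sum>v\<in>b ` W. u v * v w)"
    by (simp add: sum_fun_apply scale_apply)
  also have "\<dots> = (\<Sum>v\<in>b ` W. if v = b w then u (b w) else 0)"
  proof (intro sum.cong refl)
    fix v assume "v \<in> b ` W"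
    then obtain w' where w': "w' \<in> W" "v = b w'" by blast
    show "u v * v w = (if v = b w then u (b w) else 0)"
      using w' w diagonal[of w] triangular[of w' w] min[of w'] by auto
  qed
  also have "\<dots> = u (b w)" using W w by simp
  finally show False using w by simp
qed

text \<open>Back substitution, starting with a word of minimal key in \<open>U\<close>: the tensors
  of the other words of \<open>U\<close> vanish there and cannot disturb the value once it is
  fixed.\<close>

lemma triangular_interpolation:
  assumes "U \<subseteq> W"
  shows "\<exists>g \<in> tensors.span (b ` U). \<forall>w\<in>U. g w = f w"
  using finite_subset[OF assms W] assms
proof (induction "card U" arbitrary: U f)
  case 0
  then show ?case by (auto intro: tensors.span_zero)
next
  case (Suc k)
  then have U: "finite U" "U \<noteq> {}" by auto
  define w where "w = arg_min_on key U"
  have min: "\<not> key w' < key w" if "w' \<in> U" for w'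
    using arg_min_if_finite(2)[OF U, of key] that by (auto simp: w_def)
  have w: "w \<in> U"
    using arg_min_if_finite(1)[OF U, of key] by (simp add: w_def)
  have "k = card (U - {w})" using Suc.hyps(2) w by simp
  \<comment> \<open>The multiple \<open>scale (f w) (b w)\<close> is set aside for \<open>w\<close>;
    the induction hypothesis interpolates what is left of \<open>f\<close> on the other
    words.\<close>
  then obtain g where g: "g \<in> tensors.span (b ` (U - {w}))"
    "\<forall>v\<in>U - {w}. g v = f v - f w * b w v"
    using Suc.hyps(1)[of "U - {w}" "\<lambda>v. f v - f w * b w v"] Suc.prems by blast
  have "h w = 0" if "h \<in> tensors.span (b ` (U - {w}))" for h
    using that
  proof (induction rule: tensors.span_induct)
    case base
    show ?case by (auto simp: tensors.subspace_def scale_apply)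
  next
    case (step h)
    then obtain v where "v \<in> U" "v \<noteq> w" "h = b v" by blast
    then show ?case using triangular[of v w] min[of v] w Suc.prems by blast
  qed
  with g have gw: "g w = 0" by blast
  have "g + scale (f w) (b w) \<in> tensors.span (b ` U)"
  proof (rule tensors.span_add)
    show "g \<in> tensors.span (b ` U)"
      using g(1) tensors.span_mono[of "b ` (U - {w})" "b ` U"] by blast
    show "scale (f w) (b w) \<in> tensors.span (b ` U)"
      using w by (intro tensors.span_scale tensors.span_base) blast
  qed
  moreover have "(g + scale (f w) (b w)) v = f v" if "v \<in> U" for v
    using that g(2) gw diagonal[of w] w Suc.prems by (cases "v = w") (auto simp: scale_apply)
  ultimately show ?case by blast
qed

text \<open>Any \<open>f\<close> in \<open>A\<close> is interpolated on \<open>U\<close> by some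
  \<open>g\<close> in the span of the \<open>b w\<close> with \<open>w\<close> in \<open>U\<close>.
  The difference lies in \<open>A\<close> and vanishes on \<open>U\<close>, so \<open>f = g\<close>,
  and \<open>A\<close> is spanned by part of the basis.\<close>

lemma generates_distributive_lattice_if_triangular:
  assumes G: "\<And>A. A \<in> G \<Longrightarrow> tensors.subspace A \<and>
    (\<exists>U\<subseteq>W. b ` U \<subseteq> A \<and> (\<forall>f\<in>A. (\<forall>w\<in>U. f w = 0) \<longrightarrow> f = 0))"
  shows "generates_distributive_lattice G"
proof (rule generates_distributive_lattice_if_basis[OF triangular_independent])
  fix A assume "A \<in> G"
  from G[OF this] have A: "tensors.subspace A" by (rule conjunct1)
  from G[OF \<open>A \<in> G\<close>, THEN conjunct2] obtain U
    where U: "U \<subseteq> W \<and> b ` U \<subseteq> A \<and> (\<forall>f\<in>A. (\<forall>w\<in>U. f w = 0) \<longrightarrow> f = 0)"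
    by (rule exE)
  then have vanish: "f = 0" if "f \<in> A" "\<forall>w\<in>U. f w = 0" for f
    using that by simp
  from U have U: "U \<subseteq> W" "b ` U \<subseteq> A" by simp_all
  have span: "tensors.span (b ` U) \<subseteq> A"
    using U A by (simp add: tensors.span_minimal)
  have "f \<in> tensors.span (b ` U)" if "f \<in> A" for f
  proof -
    obtain g where g: "g \<in> tensors.span (b ` U)" "\<forall>w\<in>U. g w = f w"
      using triangular_interpolation[OF U(1)] by blast
    then have "f - g \<in> A"
      using tensors.subspace_diff[OF A that] span by blast
    then have "f - g = 0" using vanish[of "f - g"] g(2) by auto
    then show ?thesis using g(1) by simp
  qed
  with span have "A = tensors.span (b ` U)" by blast
  with U(1) show "\<exists>C\<subseteq>b ` W. A = tensors.span C" by blast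
qed

end


section \<open>Homogeneous tensors\<close>

lemma tensor_power_eq_0: "f \<in> tensor_power X k \<Longrightarrow> length w \<noteq> k \<Longrightarrow> f w = 0"
  by (auto simp: tensor_power_def supp_def)

lemma in_tensor_powerI:
  assumes "finite X" "\<And>w. f w \<noteq> 0 \<Longrightarrow> length w = k \<and> set w \<subseteq> X"
  shows "f \<in> tensor_power X k"
proof -
  have "supp f \<subseteq> {w. set w \<subseteq> X \<and> length w = k}" using assms(2) by (auto simp: supp_def)
  moreover have "finite {w. set w \<subseteq> X \<and> length w = k}"
    using assms(1) by (rule finite_lists_length_eq)
  ultimately have "finite (supp f)" by (rule finite_subset)
  then show ?thesis
    using assms(2) by (auto simp: tensor_power_def in_carrier_tensor_algebra supp_def)
qed

text \<open>Only the cut after \<open>k\<close> letters contributes, because \<open>f\<close>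
  vanishes on words of any other length.\<close>

lemma tprod_append:
  assumes "f \<in> tensor_power X k" "length u = k"
  shows "(f \<star> g) (u @ v) = f u * g v"
proof -
  have "(f \<star> g) (u @ v) = (\<Sum>j\<le>length (u @ v). if j = k then f u * g v else 0)"
    unfolding tprod_def
  proof (intro sum.cong refl)
    fix j assume "j \<in> {..length (u @ v)}"
    then show "f (take j (u @ v)) * g (drop j (u @ v)) = (if j = k then f u * g v else 0)"
      using assms tensor_power_eq_0[OF assms(1), of "take j (u @ v)"] by auto
  qed
  then show ?thesis using assms(2) by simp
qed

lemma tprod_tensor_power:
  assumes "f \<in> tensor_power X k" "g \<in> tensor_power X l"
  shows "f \<star> g \<in> tensor_power X (k + l)"
proof -
  have "length w = k + l" if "w \<in> supp (f \<star> g)" for w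
    using that supp_tprod[of f g] assms by (auto simp: tensor_power_def)
  then show ?thesis using assms tprod_closed[of f X g] by (simp add: tensor_power_def)
qed

lemma word_tensor_power: "set w \<subseteq> X \<Longrightarrow> word w \<in> tensor_power X (length w)"
  by (auto simp: tensor_power_def in_carrier_tensor_algebra supp_word)

lemma subspace_tensor: "tensors.subspace (tensor A B)"
  by (simp add: tensor_def)

lemma tprod_in_tensor: "a \<in> A \<Longrightarrow> b \<in> B \<Longrightarrow> a \<star> b \<in> tensor A B"
  unfolding tensor_def by (rule tensors.span_base) blast

lemma tensor_induct:
  assumes "f \<in> tensor A B" "tensors.subspace C" "\<And>a b. a \<in> A \<Longrightarrow> b \<in> B \<Longrightarrow> a \<star> b \<in> C"
  shows "f \<in> C"
proof -
  have "tensor A B \<subseteq> C"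
    unfolding tensor_def using assms(2,3) by (intro tensors.span_minimal) blast+
  with assms(1) show ?thesis by blast
qed


section \<open>The quadratic dual of the path algebra\<close>

primrec cover :: "path_gen \<Rightarrow> nat set" where
  "cover (Vertex i) = {i}"
| "cover (Edge i) = {i, Suc i}"

definition before :: "path_gen \<Rightarrow> path_gen \<Rightarrow> bool"
  where "before a b \<longleftrightarrow> (\<forall>i\<in>cover a. \<forall>j\<in>cover b. i < j)"

fun reduce :: "nat set \<Rightarrow> path_gen \<Rightarrow> path_gen option" where
  "reduce C (Vertex i) = (if i \<in> C then None else Some (Vertex i))"
| "reduce C (Edge i) =
    (if i \<in> C then if Suc i \<in> C then None else Some (Vertex (Suc i))
     else if Suc i \<in> C then Some (Vertex i) else Some (Edge i))"

lemma cover_nonempty: "cover a \<noteq> {}"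
  by (cases a) auto

lemma cover_eq_iff: "cover a = cover b \<longleftrightarrow> a = b"
  by (cases a; cases b) (auto simp: doubleton_eq_iff)

lemma path_gens_iff_cover: "g \<in> path_gens n \<longleftrightarrow> cover g \<subseteq> {1..n}"
  by (cases g) (auto simp: path_gens_def)

lemma reduce_eq_None_iff: "reduce C g = None \<longleftrightarrow> cover g \<subseteq> C"
  by (cases g) auto

text \<open>Every nonempty subset of a cover is the cover of exactly one generator, so one equation
  of vertex sets replaces the case distinctions of \<open>reduce\<close>.\<close>

lemma reduce_eq_Some_iff: "reduce C g = Some h \<longleftrightarrow> cover h = cover g - C"
proof -
  have *: "cover k = cover g - C" if "reduce C g = Some k" for k
    using that by (cases g) (auto split: if_splits)
  show ?thesis
  proof
    assume h: "cover h = cover g - C"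
    then have "\<not> cover g \<subseteq> C" using cover_nonempty[of h] by blast
    then obtain k where "reduce C g = Some k"
      using reduce_eq_None_iff[of C g] by auto
    with h * show "reduce C g = Some h" by (metis cover_eq_iff)
  qed (rule *)
qed

lemma reduce_cong: "cover a - C = cover b - D \<Longrightarrow> reduce C a = reduce D b"
proof (cases "reduce D b")
  case None
  assume "cover a - C = cover b - D"
  with None show ?thesis
    by (metis Diff_eq_empty_iff reduce_eq_None_iff)
next
  case (Some h)
  assume "cover a - C = cover b - D"
  moreover have "cover h = cover b - D" using Some by (simp add: reduce_eq_Some_iff)
  ultimately have "reduce C a = Some h" by (simp add: reduce_eq_Some_iff)
  with Some show ?thesis by simp
qed

lemma before_irrefl: "\<not> before a a"
  by (cases a) (auto simp: before_def)

lemma before_asym: "before a b \<Longrightarrow> \<not> before b a"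
  by (cases a; cases b) (auto simp: before_def)

lemma before_trans: "before a b \<Longrightarrow> before b c \<Longrightarrow> before a c"
  using cover_nonempty[of b] by (auto simp: before_def) (meson less_trans)

lemma before_disjoint: "before a b \<Longrightarrow> cover a \<inter> cover b = {}"
  by (auto simp: before_def)

text \<open>Covers are blocks of consecutive vertices, so of two disjoint ones, one lies entirely to
  the left of the other.\<close>

lemma disjoint_imp_before: "cover a \<inter> cover b = {} \<Longrightarrow> before a b \<or> before b a"
  by (cases a; cases b) (auto simp: before_def)

text \<open>
  The monomial representation of the quadratic dual on the span of the sets of generators with
  disjoint covers: \<open>None\<close> is the zero vector, and \<open>Some (c, s)\<close> is \<open>c\<close> times the
  basis vector \<open>s\<close>. The sign counts the elements that \<open>h\<close> passes on the way to its
  position in the sorted word.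
\<close>

definition act :: "path_gen \<Rightarrow> ('f::field \<times> path_gen set) option \<Rightarrow> ('f \<times> path_gen set) option"
  where "act g S = (case S of None \<Rightarrow> None | Some (c, s) \<Rightarrow>
    (case reduce (\<Union> (cover ` s)) g of None \<Rightarrow> None
     | Some h \<Rightarrow> Some ((- 1) ^ card {k \<in> s. before k h} * c, insert h s)))"

definition negate :: "('f::field \<times> path_gen set) option \<Rightarrow> ('f \<times> path_gen set) option"
  where "negate = map_option (\<lambda>(c, s). (- c, s))"

text \<open>With \<open>foldr\<close> the last letter acts first, so a letter is reduced by what
  stands to its right; this matches the dual relations, which reduce the first letter of a pair by
  the cover of the second.\<close>

definition normal_form :: "path_gen list \<Rightarrow> ('f::field \<times> path_gen set) option"
  where "normal_form w = foldr act w (Some (1, {}))"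

lemma act_None [simp]: "act g None = None"
  by (simp add: act_def)

lemma foldr_act_None [simp]: "foldr act w None = None"
  by (induction w) auto

text \<open>Carries the sign of an exchange of adjacent letters past all letters to their
  left.\<close>

lemma foldr_act_negate: "foldr act w (negate S) = negate (foldr act w S)"
proof (induction w)
  case (Cons g w)
  have "act g (negate S) = negate (act g S)" for S :: "('a \<times> path_gen set) option"
    by (auto simp: act_def negate_def split: option.splits)
  with Cons show ?case by simp
qed simp

lemma normal_form_Cons: "normal_form (g # w) = act g (normal_form w)"
  by (simp add: normal_form_def)

text \<open>The generator inserted by a letter covers exactly the vertices of that letter that were
  free. It is therefore new, and afterwards all vertices of the letter are covered.\<close>

lemma normal_form_SomeD:
  "normal_form w = Some (c, s) \<Longrightarrow>
    finite s \<and> card s = length w \<and> \<Union> (cover ` s) = \<Union> (cover ` set w)"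
proof (induction w arbitrary: c s)
  case Nil
  then show ?case by (simp add: normal_form_def)
next
  case (Cons g w)
  from Cons.prems obtain c' s' h where w: "normal_form w = Some (c' :: 'a, s')"
    and h: "reduce (\<Union> (cover ` s')) g = Some h" and s: "s = insert h s'"
    by (auto simp: normal_form_Cons act_def split: option.splits)
  have "cover h = cover g - \<Union> (cover ` s')"
    using h by (simp add: reduce_eq_Some_iff)
  moreover from this have "h \<notin> s'"
    using cover_nonempty[of h] by blast
  ultimately show ?case using Cons.IH[OF w] s by auto
qed

text \<open>Once \<open>b\<close> has acted, all its vertices are covered, and none of
  \<open>a\<close> is left free.\<close>

lemma act_act_reduce_None:
  assumes "reduce (cover b) a = None"
  shows "act a (act b S) = None"
proof -
  have "reduce (\<Union> (cover ` insert h s)) a = None"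
    if "reduce (\<Union> (cover ` s)) b = Some h" for h s
    using that assms by (auto simp: reduce_eq_None_iff reduce_eq_Some_iff)
  then show ?thesis
    by (simp add: act_def split: option.split prod.split)
qed

text \<open>Once \<open>b\<close> has acted, \<open>a\<close> and \<open>a'\<close> have the same
  free vertices.\<close>

lemma act_act_reduce_Some:
  assumes "reduce (cover b) a = Some a'"
  shows "act a (act b S) = act a' (act b S)"
proof -
  have "reduce (\<Union> (cover ` insert h s)) a = reduce (\<Union> (cover ` insert h s)) a'"
    if "reduce (\<Union> (cover ` s)) b = Some h" for h s
    using that assms by (intro reduce_cong) (auto simp: reduce_eq_Some_iff)
  then show ?thesis
    by (auto simp: act_def split: option.splits)
qed

text \<open>With disjoint covers, neither letter affects how the other is reduced. Of the two
  inserted generators exactly one is before the other, so exactly one order of acting picks up an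
  additional sign.\<close>

lemma act_act_disjoint:
  assumes ab: "cover a \<inter> cover b = {}" and S: "\<And>c s. S = Some (c, s) \<Longrightarrow> finite s"
  shows "act a (act b S) = negate (act b (act a S))"
proof (cases S)
  case (Some cs)
  obtain c s where cs: "S = Some (c, s)" using Some by (cases cs) auto
  let ?C = "\<Union> (cover ` s)"
  have a: "reduce (\<Union> (cover ` insert h s)) a = reduce ?C a" if "reduce ?C b = Some h" for h
    using that ab by (intro reduce_cong) (auto simp: reduce_eq_Some_iff)
  have b: "reduce (\<Union> (cover ` insert h s)) b = reduce ?C b" if "reduce ?C a = Some h" for h
    using that ab by (intro reduce_cong) (auto simp: reduce_eq_Some_iff)
  show ?thesis
  proof (cases "reduce ?C a = None \<or> reduce ?C b = None")
    case True
    then show ?thesis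
      using a b by (auto simp: act_def negate_def cs split: option.splits)
  next
    case False
    then obtain a' b' where a': "reduce ?C a = Some a'" and b': "reduce ?C b = Some b'" by auto
    \<comment> \<open>\<open>N g h\<close> is the sign exponent of the second action, when
      \<open>h\<close> has already been inserted; \<open>M g\<close> is that of a first
      action.\<close>
    define N where "N g h = card {k \<in> insert h s. before k g}" for g h
    define M where "M g = card {k \<in> s. before k g}" for g
    have cov: "cover a' = cover a - ?C" "cover b' = cover b - ?C"
      using a' b' by (simp_all add: reduce_eq_Some_iff)
    have notin: "a' \<notin> s" "b' \<notin> s"
      using cov cover_nonempty[of a'] cover_nonempty[of b'] by blast+
    have N: "N g h = M g + (if before h g then 1 else 0)" if "h \<notin> s" for g h
    proof -
      have "{k \<in> insert h s. before k g} = (if before h g then insert h else id) {k \<in> s. before k g}"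
        by auto
      then show ?thesis using that S[OF cs] by (simp add: N_def M_def)
    qed
    have "before a' b' \<longleftrightarrow> \<not> before b' a'"
      using ab cov disjoint_imp_before[of a' b'] before_asym by blast
    then have "(- 1) ^ N a' b' * ((- 1) ^ M b' * c) = - ((- 1) ^ N b' a' * ((- 1) ^ M a' * c))"
      by (simp add: N notin power_add mult.left_commute)
    then show ?thesis
      using a' b' a[OF b'] b[OF a'] by (simp add: act_def negate_def cs N_def M_def insert_commute)
  qed
qed (simp add: negate_def)


section \<open>Tensors satisfying the relations at one position\<close>

text \<open>
  The relations of the quadratic dual, read as linear conditions on the coefficients of a tensor.
\<close>

definition dual_relations ::
    "(path_gen list \<Rightarrow> 'f::field) \<Rightarrow> path_gen list \<Rightarrow> path_gen list \<Rightarrow> bool"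
  where "dual_relations f p q \<longleftrightarrow> (\<forall>a b.
    (reduce (cover b) a = None \<longrightarrow> f (p @ a # b # q) = 0) \<and>
    (\<forall>a'. reduce (cover b) a = Some a' \<longrightarrow> f (p @ a # b # q) = f (p @ a' # b # q)) \<and>
    (cover a \<inter> cover b = {} \<longrightarrow> f (p @ a # b # q) = - f (p @ b # a # q)))"

text \<open>Straightening: reducing \<open>a\<close> by the cover of \<open>b\<close> makes the
  covers disjoint, and an exchange then puts the pair in order at the cost of a sign.\<close>

lemma dual_relations_vanish:
  assumes f: "dual_relations f p q" and "\<And>a b. before a b \<Longrightarrow> f (p @ a # b # q) = 0"
  shows "f (p @ a # b # q) = 0"
proof (cases "reduce (cover b) a")
  case None
  then show ?thesis using f by (simp add: dual_relations_def)
next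
  case (Some a')
  then have "cover a' \<inter> cover b = {}" by (auto simp: reduce_eq_Some_iff)
  moreover from this have "f (p @ a' # b # q) = - f (p @ b # a' # q)"
    using f by (simp add: dual_relations_def)
  ultimately have "f (p @ a' # b # q) = 0"
    using assms(2) disjoint_imp_before[of a' b] by auto
  then show ?thesis using f Some by (simp add: dual_relations_def)
qed

text \<open>The conditions are linear and homogeneous, so they survive a factor that does not depend
  on the two letters. In products of tensors the other factors provide it.\<close>

lemma dual_relations_mult:
  assumes "dual_relations f p q"
    and "\<And>a b. g (p' @ a # b # q') = c * f (p @ a # b # q)"
  shows "dual_relations g p' q'"
  using assms by (auto simp: dual_relations_def)

lemma subspace_dual_relations:
  "tensors.subspace {f \<in> tensor_power X m. \<forall>p q. P p q \<longrightarrow> dual_relations f p q}"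
  using subspace_tensor_power[of X m]
  by (auto simp: tensors.subspace_def dual_relations_def scale_apply)

section \<open>The defining relations compared with the dual relations\<close>

lemma word_tprod_word: "word u \<star> word v = (word (u @ v) :: 'x list \<Rightarrow> 'f::field)"
proof
  fix w
  have "word u (take k w) * word v (drop k w) =
      (if k = length u then word (u @ v) w else 0 :: 'f)" if "k \<le> length w" for k
  proof (cases "k = length u")
    case True
    then show ?thesis
      by (metis append_eq_conv_conj append_take_drop_id mult.right_neutral mult_zero_left
          mult_zero_right word_def)
  next
    case False
    with that show ?thesis by (auto simp: word_def)
  qed
  then have "(word u \<star> word v) w = (\<Sum>k\<le>length w. if k = length u then word (u @ v) w else 0 :: 'f)"
    unfolding tprod_def by (intro sum.cong) auto
  then show "(word u \<star> word v) w = (word (u @ v) w :: 'f)"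
    by (auto simp: word_def)
qed

lemma tprod_diff_right: "f \<star> (g - h) = f \<star> g - f \<star> h"
  by (simp add: tprod_def fun_eq_iff algebra_simps sum_subtractf)

lemmas path_relation_simps = comm_def vert_def edge_def tprod_diff_right word_tprod_word

lemma dual_relationsI:
  assumes "\<And>i. r [Vertex i, Vertex i] = 0" "\<And>i. r [Vertex i, Edge i] = 0"
    "\<And>i. r [Vertex (Suc i), Edge i] = 0" "\<And>i. r [Edge i, Edge i] = 0"
    and "\<And>i. r [Edge i, Vertex i] = r [Vertex (Suc i), Vertex i]"
    "\<And>i. r [Edge i, Vertex (Suc i)] = r [Vertex i, Vertex (Suc i)]"
    "\<And>i. r [Edge i, Edge (Suc i)] = r [Vertex i, Edge (Suc i)]"
    "\<And>i. r [Edge (Suc i), Edge i] = r [Vertex (Suc (Suc i)), Edge i]"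
    and "\<And>i j. i < j \<Longrightarrow> r [Vertex i, Vertex j] = - r [Vertex j, Vertex i]"
    "\<And>i j. Suc i < j \<Longrightarrow> r [Edge i, Edge j] = - r [Edge j, Edge i]"
    "\<And>i j. j < i \<or> Suc i < j \<Longrightarrow> r [Vertex j, Edge i] = - r [Edge i, Vertex j]"
  shows "dual_relations r [] []"
  unfolding dual_relations_def append_Nil
proof (intro allI conjI impI)
  fix a b assume "reduce (cover b) a = None"
  then show "r [a, b] = 0"
    using assms(1-4) by (cases a; cases b) (auto split: if_splits)
next
  fix a b a' assume "reduce (cover b) a = Some a'"
  then show "r [a, b] = r [a', b]"
    using assms(5-8) by (cases a; cases b) (auto split: if_splits)
next
  fix a b assume "cover a \<inter> cover b = {}"
  then have "before a b \<or> before b a" by (rule disjoint_imp_before)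
  then show "r [a, b] = - r [b, a]"
    using assms(9-11) by (cases a; cases b) (auto simp: before_def)
qed

text \<open>Orthogonality of the relations and their dual, checked on the coefficients of each
  family of relations.\<close>

lemma path_relations_dual_relations:
  assumes "r \<in> path_relations n"
  shows "dual_relations r [] []"
  using assms unfolding path_relations_def path_relation_simps append_Cons append_Nil
  by (elim UnE CollectE exE conjE; intro dual_relationsI; auto simp: word_def)

lemma path_relations_intros:
  "i \<in> {1..n} \<Longrightarrow> j \<in> {1..n} \<Longrightarrow> j > i + 1 \<Longrightarrow> comm (vert i) (vert j) \<in> path_relations n"
  "i \<in> {1..n - 1} \<Longrightarrow>
    comm (vert i) (vert (i + 1)) + edge i \<star> (vert (i + 1) - vert i) \<in> path_relations n"
  "i \<in> {1..n - 1} \<Longrightarrow> j \<in> {1..n - 1} \<Longrightarrow> j > i + 1 \<Longrightarrow> comm (edge i) (edge j) \<in> path_relations n"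
  "i \<in> {1..n} \<Longrightarrow> j \<in> {1..n - 1} \<Longrightarrow> j > i + 1 \<or> j + 2 < i \<Longrightarrow>
    comm (vert i) (edge j) \<in> path_relations n"
  "i \<in> {1..n - 2} \<Longrightarrow>
    comm (vert i) (edge (i + 1)) + edge i \<star> edge (i + 1) \<in> path_relations n"
  "i \<in> {1..n - 2} \<Longrightarrow>
    comm (vert (i + 2)) (edge i) + edge (i + 1) \<star> edge i \<in> path_relations n"
  unfolding path_relations_def by blast+

text \<open>Each defining relation contains exactly one ordered two-letter word, and every such word
  over the generators occurs. Its coefficient is 1, or -1 when an edge precedes a vertex, and
  \<open>c\<close> cancels the sign.\<close>

lemma path_relations_leading:
  assumes "a \<in> path_gens n" "b \<in> path_gens n" "before a b"
  shows "\<exists>c. \<exists>r\<in>path_relations n. \<forall>a' b'. before a' b' \<longrightarrow>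
    c * r [a', b'] = (if a' = a \<and> b' = b then 1 else 0 :: 'f::field)"
proof (cases a)
  case a: (Vertex i)
  show ?thesis
  proof (cases b)
    case b: (Vertex j)
    show ?thesis
    proof (cases "j = i + 1")
      case True
      then have "comm (vert i) (vert (i + 1)) + edge i \<star> (vert (i + 1) - vert i)
          \<in> (path_relations n :: (_ \<Rightarrow> 'f) set)"
        using assms a b by (intro path_relations_intros) (auto simp: path_gens_def before_def)
      then show ?thesis
        unfolding path_relation_simps append_Cons append_Nil a b True
        by (rule bexI[rotated, THEN exI[of _ 1]]) (auto simp: word_def before_def)
    next
      case False
      then have "comm (vert i) (vert j) \<in> (path_relations n :: (_ \<Rightarrow> 'f) set)"
        using assms a b by (intro path_relations_intros) (auto simp: path_gens_def before_def)
      then show ?thesis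
        unfolding path_relation_simps append_Cons append_Nil a b
        by (rule bexI[rotated, THEN exI[of _ 1]]) (use assms a b in \<open>auto simp: word_def before_def\<close>)
    qed
  next
    case b: (Edge j)
    show ?thesis
    proof (cases "j = i + 1")
      case True
      then have "comm (vert i) (edge (i + 1)) + edge i \<star> edge (i + 1)
          \<in> (path_relations n :: (_ \<Rightarrow> 'f) set)"
        using assms a b by (intro path_relations_intros) (auto simp: path_gens_def before_def)
      then show ?thesis
        unfolding path_relation_simps append_Cons append_Nil a b True
        by (rule bexI[rotated, THEN exI[of _ 1]]) (auto simp: word_def before_def)
    next
      case False
      then have "comm (vert i) (edge j) \<in> (path_relations n :: (_ \<Rightarrow> 'f) set)"
        using assms a b by (intro path_relations_intros) (auto simp: path_gens_def before_def)
      then show ?thesis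
        unfolding path_relation_simps append_Cons append_Nil a b
        by (rule bexI[rotated, THEN exI[of _ 1]]) (use assms a b in \<open>auto simp: word_def before_def\<close>)
    qed
  qed
next
  case a: (Edge i)
  show ?thesis
  proof (cases b)
    case b: (Vertex j)
    show ?thesis
    proof (cases "j = i + 2")
      case True
      then have "comm (vert (i + 2)) (edge i) + edge (i + 1) \<star> edge i
          \<in> (path_relations n :: (_ \<Rightarrow> 'f) set)"
        using assms a b by (intro path_relations_intros) (auto simp: path_gens_def before_def)
      then show ?thesis
        unfolding path_relation_simps append_Cons append_Nil a b True
        by (rule bexI[rotated, THEN exI[of _ "- 1"]]) (auto simp: word_def before_def)
    next
      case False
      then have "comm (vert j) (edge i) \<in> (path_relations n :: (_ \<Rightarrow> 'f) set)"
        using assms a b by (intro path_relations_intros) (auto simp: path_gens_def before_def)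
      then show ?thesis
        unfolding path_relation_simps append_Cons append_Nil a b
        by (rule bexI[rotated, THEN exI[of _ "- 1"]]) (use assms a b in \<open>auto simp: word_def before_def\<close>)
    qed
  next
    case b: (Edge j)
    then have "comm (edge i) (edge j) \<in> (path_relations n :: (_ \<Rightarrow> 'f) set)"
      using assms a b by (intro path_relations_intros) (auto simp: path_gens_def before_def)
    then show ?thesis
      unfolding path_relation_simps append_Cons append_Nil a b
      by (rule bexI[rotated, THEN exI[of _ 1]]) (use assms a b in \<open>auto simp: word_def before_def\<close>)
  qed
qed

section \<open>Relation subspaces as solution spaces of the dual relations\<close>

definition relation_tensors :: "nat \<Rightarrow> nat \<Rightarrow> nat \<Rightarrow> (path_gen list \<Rightarrow> 'f::field) set"
  where "relation_tensors n k l = {f \<in> tensor_power (path_gens n) (k + 2 + l).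
    \<forall>p q. length p = k \<and> length q = l \<longrightarrow> dual_relations f p q}"

definition leading_words :: "nat \<Rightarrow> nat \<Rightarrow> nat \<Rightarrow> path_gen list set"
  where "leading_words n k l = {p @ a # b # q | p a b q.
    set (p @ a # b # q) \<subseteq> path_gens n \<and> length p = k \<and> length q = l \<and> before a b}"

lemma subspace_relation_tensors: "tensors.subspace (relation_tensors n k l)"
  unfolding relation_tensors_def by (rule subspace_dual_relations)

lemma finite_path_gens: "finite (path_gens n)"
  by (simp add: path_gens_def)

lemma finite_leading_words: "finite (leading_words n k l)"
proof (rule finite_subset)
  show "leading_words n k l \<subseteq> {w. set w \<subseteq> path_gens n \<and> length w = k + 2 + l}"
    by (auto simp: leading_words_def)
  show "finite \<dots>" using finite_path_gens by (rule finite_lists_length_eq)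
qed

lemma tensor_power_support: "f \<in> tensor_power X m \<Longrightarrow> \<not> set w \<subseteq> X \<Longrightarrow> f w = 0"
  by (auto simp: tensor_power_def in_carrier_tensor_algebra supp_def)

lemma relation_tensors_vanish:
  assumes f: "f \<in> relation_tensors n k l" and 0: "\<And>w. w \<in> leading_words n k l \<Longrightarrow> f w = 0"
  shows "f = 0"
proof
  fix w
  have T: "f \<in> tensor_power (path_gens n) (k + 2 + l)"
    using f by (simp add: relation_tensors_def)
  show "f w = 0 w"
  proof (cases "length w = k + 2 + l")
    case True
    then have "length (drop k w) = Suc (Suc l)" by simp
    then obtain a b q where "drop k w = a # b # q" and q: "length q = l"
      by (metis length_Suc_conv)
    then have w: "w = take k w @ a # b # q" by (metis append_take_drop_id)
    have p: "length (take k w) = k" using True by (simp add: min_def)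
    \<comment> \<open>Straightening ranges over all generators; words with a letter outside
      \<open>path_gens n\<close> are handled by the support of \<open>f\<close>.\<close>
    have "f (take k w @ a' # b' # q) = 0" if "before a' b'" for a' b'
    proof (cases "set (take k w @ a' # b' # q) \<subseteq> path_gens n")
      case True
      with that p q have "take k w @ a' # b' # q \<in> leading_words n k l"
        unfolding leading_words_def by blast
      then show ?thesis by (rule 0)
    qed (use T in \<open>rule tensor_power_support\<close>)
    moreover have "dual_relations f (take k w) q"
      using f p q unfolding relation_tensors_def by blast
    ultimately have "f (take k w @ a # b # q) = 0"
      by (rule dual_relations_vanish[rotated])
    then show ?thesis by (simp flip: w)
  qed (simp add: tensor_power_eq_0[OF T])
qed

lemma scale_tprod: "scale c f \<star> g = scale c (f \<star> g)"
  by (simp add: tprod_def scale_def sum_distrib_left mult.assoc)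

lemma zero_tprod: "0 \<star> g = 0"
  by (simp add: tprod_def fun_eq_iff)

lemma tprod_relation_tensors:
  assumes r: "r \<in> relation_tensors n 0 0"
    and s: "s \<in> tensor_power (path_gens n) k" and t: "t \<in> tensor_power (path_gens n) l"
  shows "s \<star> r \<star> t \<in> relation_tensors n k l"
  unfolding relation_tensors_def
proof (intro CollectI conjI allI impI)
  have r2: "r \<in> tensor_power (path_gens n) 2"
    using r by (simp add: relation_tensors_def numeral_2_eq_2)
  note sr = tprod_tensor_power[OF s r2]
  show "s \<star> r \<star> t \<in> tensor_power (path_gens n) (k + 2 + l)"
    by (rule tprod_tensor_power[OF sr t])
  fix p q :: "path_gen list" assume "length p = k \<and> length q = l"
  then have p: "length p = k" and q: "length q = l" by simp_all
  have "(s \<star> r \<star> t) (p @ a # b # q) = s p * t q * r ([] @ a # b # [])" for a b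
    using tprod_append[OF sr, of "p @ [a, b]" t q] tprod_append[OF s p, of r "[a, b]"] p
    by (simp add: ac_simps)
  moreover have "dual_relations r [] []"
    using r by (simp add: relation_tensors_def)
  ultimately show "dual_relations (s \<star> r \<star> t) p q"
    by (rule dual_relations_mult[rotated])
qed

text \<open>Products with a relation inherit its dual relations, which gives one inclusion.
  Conversely, the relation subspace contains a family dual to evaluation at the leading words, and a
  solution is determined by its values there.\<close>

lemma relation_tensors_eq:
  fixes n k l
  defines "X \<equiv> path_gens n"
  shows "tensor (tensor (tensor_power X k) (tensors.span (path_relations n))) (tensor_power X l) =
    (relation_tensors n k l :: (_ \<Rightarrow> 'f::field) set)" (is "?T = _")
proof
  let ?R = "tensors.span (path_relations n) :: (_ \<Rightarrow> 'f) set"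
  have R: "?R \<subseteq> relation_tensors n 0 0"
  proof (rule tensors.span_minimal[OF _ subspace_relation_tensors])
    show "path_relations n \<subseteq> relation_tensors n 0 0"
      using path_relations_quadratic[of n]
      by (auto simp: relation_tensors_def numeral_2_eq_2 intro: path_relations_dual_relations)
  qed
  show sub: "?T \<subseteq> relation_tensors n k l"
  proof
    fix f assume "f \<in> ?T"
    then show "f \<in> relation_tensors n k l"
    proof (rule tensor_induct[OF _ subspace_relation_tensors])
      fix u t :: "_ \<Rightarrow> 'f" assume t: "t \<in> tensor_power X l" and "u \<in> tensor (tensor_power X k) ?R"
      \<comment> \<open>The outer factor \<open>t\<close> is fixed, so that a second induction can
        run over the inner tensor product.\<close>
      from this(2) have "u \<in> {u. u \<star> t \<in> relation_tensors n k l}"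
      proof (rule tensor_induct)
        show "tensors.subspace {u. u \<star> t \<in> relation_tensors n k l}"
          using subspace_relation_tensors[of n k l]
          unfolding tensors.subspace_def mem_Collect_eq tprod_distrib_right scale_tprod zero_tprod
          by blast
        fix s r :: "_ \<Rightarrow> 'f" assume "s \<in> tensor_power X k" "r \<in> ?R"
        then show "s \<star> r \<in> {u. u \<star> t \<in> relation_tensors n k l}"
          using R t tprod_relation_tensors unfolding X_def by blast
      qed
      then show "u \<star> t \<in> relation_tensors n k l" by simp
    qed
  qed
  have sT: "tensors.subspace ?T" by (rule subspace_tensor)
  have "\<exists>e\<in>?T. \<forall>w'\<in>leading_words n k l. e w' = (if w' = w then 1 else 0)"
    if w: "w \<in> leading_words n k l" for w
  proof -
    obtain p a b q where w: "w = p @ a # b # q" and pq: "length p = k" "length q = l" and "before a b"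
      and X: "set p \<subseteq> X" "a \<in> X" "b \<in> X" "set q \<subseteq> X"
      using w by (auto simp: leading_words_def X_def)
    have "a \<in> path_gens n" "b \<in> path_gens n" using X by (simp_all add: X_def)
    from path_relations_leading[OF this \<open>before a b\<close>]
    obtain c and r :: "_ \<Rightarrow> 'f" where r: "r \<in> path_relations n"
      and "\<forall>a' b'. before a' b' \<longrightarrow> c * r [a', b'] = (if a' = a \<and> b' = b then 1 else 0)"
      by (elim exE bexE)
    then have rc: "c * r [a', b'] = (if a' = a \<and> b' = b then 1 else 0)" if "before a' b'" for a' b'
      using that by simp
    have p: "word p \<in> tensor_power X k" and q: "word q \<in> tensor_power X l"
      using word_tensor_power X pq by blast+
    have rR: "r \<in> ?R" using r by (rule tensors.span_base)
    have r2: "r \<in> tensor_power X 2"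
      using r path_relations_quadratic unfolding X_def by blast
    \<comment> \<open>The relation with ordered word \<open>a b\<close>, flanked by the words
      \<open>p\<close> and \<open>q\<close>, takes the value 1 at \<open>w\<close> and 0 at all
      other leading words.\<close>
    let ?e = "scale c (word p \<star> r \<star> word q)"
    have "?e \<in> ?T"
      using p q rR by (intro tensors.subspace_scale[OF sT] tprod_in_tensor)
    moreover have "?e w' = (if w' = w then 1 else 0)" if "w' \<in> leading_words n k l" for w'
    proof -
      obtain p' a' b' q' where w': "w' = p' @ a' # b' # q'" and p': "length p' = k"
        and "before a' b'"
        using \<open>w' \<in> leading_words n k l\<close> by (auto simp: leading_words_def)
      have "?e w' = (word p p' * word q q') * (c * r [a', b'])"
        using tprod_append[OF tprod_tensor_power[OF p r2], of "p' @ [a', b']" "word q" q']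
          tprod_append[OF p p', of r "[a', b']"] p' w'
        by (simp add: scale_apply ac_simps)
      then show ?thesis
        unfolding rc[OF \<open>before a' b'\<close>] using w w' p' pq by (auto simp: word_def)
    qed
    ultimately show ?thesis by blast
  qed
  then obtain e where e: "\<And>w. w \<in> leading_words n k l \<Longrightarrow> e w \<in> ?T"
    and e_eq: "\<And>w w'. w \<in> leading_words n k l \<Longrightarrow> w' \<in> leading_words n k l \<Longrightarrow>
      e w w' = (if w' = w then 1 else 0)"
    by metis
  show "relation_tensors n k l \<subseteq> ?T"
  proof
    fix f :: "_ \<Rightarrow> 'f" assume f: "f \<in> relation_tensors n k l"
    define g where "g = (\<Sum>w\<in>leading_words n k l. scale (f w) (e w))"
    have g: "g \<in> ?T"
      unfolding g_def using e by (intro tensors.subspace_sum[OF sT] tensors.subspace_scale[OF sT])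
    have "f - g = 0"
    proof (rule relation_tensors_vanish)
      show "f - g \<in> relation_tensors n k l"
        using tensors.subspace_diff[OF subspace_relation_tensors f] g sub by blast
      fix w assume w: "w \<in> leading_words n k l"
      have "g w = (\<Sum>v\<in>leading_words n k l. f v * e v w)"
        by (simp add: g_def sum_fun_apply scale_apply)
      also have "\<dots> = (\<Sum>v\<in>leading_words n k l. if v = w then f w else 0)"
        using w by (intro sum.cong) (auto simp: e_eq)
      finally show "(f - g) w = 0" using w finite_leading_words by simp
    qed
    with g show "f \<in> ?T" by simp
  qed
qed


section \<open>Tensors with prescribed leading words\<close>

text \<open>Numbers the generators from left to right, compatibly with \<open>before\<close>; the
  parity tells edges from vertices.\<close>

primrec code :: "path_gen \<Rightarrow> nat" where
  "code (Vertex i) = 2 * i"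
| "code (Edge i) = 2 * i + 1"

definition edges :: "path_gen list \<Rightarrow> nat"
  where "edges w = length (filter (\<lambda>g. odd (code g)) w)"

text \<open>
  The number of edges comes first because \<^const>\<open>reduce\<close> turns edges into vertices; for a fixed
  number of edges, sorting makes a word lexicographically smaller.
\<close>

definition key :: "path_gen list \<Rightarrow> nat list"
  where "key w = edges w # map code w"

lemma inj_code: "inj code"
proof (rule injI)
  fix a b assume "code a = code b"
  then show "a = b" by (cases a; cases b; simp; presburger)
qed

lemma before_code: "before a b \<Longrightarrow> code a < code b"
  by (cases a; cases b) (auto simp: before_def)

lemma key_inject: "key w = key w' \<longleftrightarrow> w = w'"
  using inj_map_eq_map[OF inj_code] by (auto simp: key_def)

lemma edges_append: "edges (u @ v) = edges u + edges v"
  by (simp add: edges_def)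

lemma append_less_append:
  fixes x y u v :: "'a::linorder list"
  assumes "length x = length y" "x < y \<or> x = y \<and> u < v"
  shows "x @ u < y @ v"
  using assms by (induction x y rule: list_induct2) auto

text \<open>Edge counts add up, and equal lengths of \<open>u\<close> and \<open>u'\<close> allow
  lexicographic comparisons to be concatenated. This passes triangularity on to products.\<close>

lemma key_append_less:
  assumes "length u = length u'" "u = u' \<or> key u < key u'" "v = v' \<or> key v < key v'"
  shows "u @ v = u' @ v' \<or> key (u @ v) < key (u' @ v')"
  using assms append_less_append[of "map code u" "map code u'" "map code v" "map code v'"]
  by (auto simp: key_def edges_append)

text \<open>By induction the sorted word of the tail is small enough. If the first letter is
  inserted unreduced, it moves right past letters of smaller code, which lowers the word
  lexicographically; if it is reduced, an edge becomes a vertex and the edge count drops.\<close>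

lemma key_normal_form:
  fixes c :: "'f::field"
  assumes "normal_form w = Some (c, s)" "sorted_wrt before u" "set u = s"
  shows "key u \<le> key w"
  using assms
proof (induction w arbitrary: c s u)
  case Nil
  then show ?case by (simp add: normal_form_def)
next
  case (Cons g w)
  from Cons.prems(1) obtain c' s' h where w: "normal_form w = Some (c' :: 'f, s')"
    and h: "reduce (\<Union> (cover ` s')) g = Some h" and s: "s = insert h s'"
    by (auto simp: normal_form_Cons act_def split: option.splits)
  from h have cov: "cover h = cover g - \<Union> (cover ` s')"
    by (simp add: reduce_eq_Some_iff)
  with cover_nonempty[of h] have "h \<notin> s'" by blast
  have "h \<in> set u" using s Cons.prems(3) by simp
  then obtain u1 u2 where u: "u = u1 @ h # u2" by (auto dest: split_list)
  with Cons.prems(2) have sorted: "sorted_wrt before (u1 @ u2)"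
    and u1: "\<forall>x\<in>set u1. before x h" and "\<forall>x\<in>set u2. before h x"
    by (auto simp: sorted_wrt_append)
  then have "h \<notin> set (u1 @ u2)" using before_irrefl[of h] by auto
  then have "set (u1 @ u2) = s'" using u s Cons.prems(3) \<open>h \<notin> s'\<close> by auto
  then have IH: "key (u1 @ u2) \<le> key w" by (rule Cons.IH[OF w sorted])
  show ?case
  proof (cases "h = g")
    case True
    have "map code u \<le> code g # map code (u1 @ u2)"
      using u1 before_code unfolding u True by (cases u1) auto
    moreover have "edges u = edges [g] + edges (u1 @ u2)" "edges (g # w) = edges [g] + edges w"
      by (simp_all add: u True edges_def)
    ultimately show ?thesis
      using IH by (auto simp: key_def intro: order_trans)
  next
    case False
    then have "odd (code g)" "even (code h)"
      using h by (cases g; auto split: if_splits)+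
    then have "edges u < edges (g # w)"
      using IH by (auto simp: key_def u edges_def)
    then show ?thesis by (simp add: key_def)
  qed
qed

text \<open>Each letter acts on generators that all lie to its right, so its cover is free and it
  passes nothing.\<close>

lemma normal_form_sorted:
  "sorted_wrt before w \<Longrightarrow> normal_form w = Some (1 :: 'f::field, set w)"
proof (induction w)
  case Nil
  then show ?case by (simp add: normal_form_def)
next
  case (Cons g w)
  then have g: "before g k" if "k \<in> set w" for k using that by simp
  then have "cover g \<inter> \<Union> (cover ` set w) = {}"
    using before_disjoint by blast
  then have "reduce (\<Union> (cover ` set w)) g = Some g"
    by (simp add: reduce_eq_Some_iff Diff_triv)
  moreover have "{k \<in> set w. before k g} = {}"
    using g before_asym by blast
  then have "(- 1) ^ card {k \<in> set w. before k g} = (1 :: 'f)"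
    by (simp only: card.empty power_0)
  ultimately show ?case
    using Cons.IH Cons.prems by (simp add: normal_form_Cons act_def)
qed

text \<open>The tensor is a matrix coefficient of the action, so the identities for two successive
  actions become its dual relations; \<open>key_normal_form\<close> makes it triangular.\<close>

lemma sorted_tensor:
  assumes w: "sorted_wrt before w" "set w \<subseteq> path_gens n"
  shows "\<exists>b\<in>tensor_power (path_gens n) (length w). b w = (1 :: 'f::field) \<and>
    (\<forall>w'. b w' \<noteq> 0 \<longrightarrow> w = w' \<or> key w < key w') \<and> (\<forall>p q. dual_relations b p q)"
proof -
  \<comment> \<open>The linear functional that reads off the coordinate at the basis vector
    \<open>set w\<close>; the zero vector \<open>None\<close> has coordinate 0.\<close>
  define coef where "coef S = (case S of None \<Rightarrow> 0 | Some (c, s) \<Rightarrow> if s = set w then c else 0)"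
    for S :: "('f \<times> path_gen set) option"
  define b where "b v = coef (normal_form v)" for v
  have card: "card (set w) = length w"
    using normal_form_SomeD[OF normal_form_sorted[OF w(1)]] by blast
  have b: "\<exists>c. normal_form v = Some (c :: 'f, set w)" if "b v \<noteq> 0" for v
    using that by (auto simp: b_def coef_def split: option.splits if_splits)
  have "b \<in> tensor_power (path_gens n) (length w)"
  proof (rule in_tensor_powerI[OF finite_path_gens])
    fix v assume "b v \<noteq> 0"
    then obtain c where "normal_form v = Some (c :: 'f, set w)" using b by blast
    from normal_form_SomeD[OF this] have "card (set w) = length v"
      and cov: "\<Union> (cover ` set w) = \<Union> (cover ` set v)" by simp_all
    then have "length v = length w" using card by simp
    moreover have "set v \<subseteq> path_gens n"
    proof
      fix g assume "g \<in> set v"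
      with cov have "cover g \<subseteq> \<Union> (cover ` set w)" by blast
      also have "\<dots> \<subseteq> {1..n}" using w(2) path_gens_iff_cover by blast
      finally show "g \<in> path_gens n" by (simp add: path_gens_iff_cover)
    qed
    ultimately show "length v = length w \<and> set v \<subseteq> path_gens n" ..
  qed
  moreover have "b w = 1"
    by (simp add: b_def coef_def normal_form_sorted[OF w(1)])
  moreover have "w = v \<or> key w < key v" if v: "b v \<noteq> 0" for v
    using b[OF v] key_normal_form[OF _ w(1)] key_inject[of w v] by (metis order_le_less)
  moreover have "dual_relations b p q" for p q
  proof -
    have fold: "b (p @ a # c # q) = coef (foldr act p (act a (act c (normal_form q))))" for a c
      by (simp add: b_def normal_form_def)
    have None: "coef None = 0" by (simp add: coef_def)
    have negate: "coef (negate S) = - coef S" for S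
      by (auto simp: coef_def negate_def split: option.splits)
    let ?q = "normal_form q :: ('f \<times> path_gen set) option"
    have disjoint: "act a (act c ?q) = negate (act c (act a ?q))" if "cover a \<inter> cover c = {}" for a c
      using that normal_form_SomeD[of q] by (intro act_act_disjoint) blast+
    show ?thesis
      unfolding dual_relations_def fold
    proof (intro allI conjI impI)
      fix a c assume "cover a \<inter> cover c = {}"
      then show "coef (foldr act p (act a (act c ?q))) = - coef (foldr act p (act c (act a ?q)))"
        by (simp only: disjoint foldr_act_negate negate)
    qed (simp_all only: act_act_reduce_None act_act_reduce_Some foldr_act_None None)
  qed
  ultimately show ?thesis by blast
qed

text \<open>A position is given by the lengths of \<open>p\<close> and \<open>q\<close> alone: where
  \<open>w\<close> has an ordered pair, the dual relations must hold in every context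
  \<open>p'\<close>, \<open>q'\<close> of these lengths, as in
  \<open>relation_tensors\<close>.\<close>

definition adapted :: "nat \<Rightarrow> path_gen list \<Rightarrow> (path_gen list \<Rightarrow> 'f::field) \<Rightarrow> bool"
  where "adapted n w b \<longleftrightarrow> b \<in> tensor_power (path_gens n) (length w) \<and> b w = 1 \<and>
    (\<forall>w'. b w' \<noteq> 0 \<longrightarrow> w = w' \<or> key w < key w') \<and>
    (\<forall>p x y q p' q'. w = p @ x # y # q \<longrightarrow> before x y \<longrightarrow>
      length p' = length p \<longrightarrow> length q' = length q \<longrightarrow> dual_relations b p' q')"

lemma adaptedD:
  assumes "adapted n w b"
  shows "b \<in> tensor_power (path_gens n) (length w)" and "b w = 1"
    and "b w' \<noteq> 0 \<Longrightarrow> w = w' \<or> key w < key w'"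
    and "w = p @ x # y # q \<Longrightarrow> before x y \<Longrightarrow> length p' = length p \<Longrightarrow> length q' = length q \<Longrightarrow>
      dual_relations b p' q'"
  using assms by (simp_all add: adapted_def)

lemma ex_adapted:
  assumes "set w \<subseteq> path_gens n"
  shows "\<exists>b :: path_gen list \<Rightarrow> 'f::field. adapted n w b"
  using assms
proof (induction "length w" arbitrary: w rule: less_induct)
  case less
  show ?case
  proof (cases "sorted_wrt before w")
    case True
    from sorted_tensor[OF this less.prems] show ?thesis
      unfolding adapted_def by (elim bexE) blast
  next
    case False
    \<comment> \<open>By transitivity, a word that is not sorted fails already at two adjacent
      letters.\<close>
    have "transp before" using before_trans by (auto intro: transpI)
    with False obtain i where i: "Suc i < length w" "\<not> before (w ! i) (w ! Suc i)"
      by (auto simp: sorted_wrt_iff_nth_Suc_transp)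
    \<comment> \<open>The cut separates the letters \<open>w ! i\<close> and
      \<open>w ! Suc i\<close>, so that no ordered pair of \<open>w\<close> straddles it.\<close>
    define u v where "u = take (Suc i) w" and "v = drop (Suc i) w"
    have w: "w = u @ v" by (simp add: u_def v_def)
    have len: "length u < length w" "length v < length w" and X: "set u \<subseteq> path_gens n" "set v \<subseteq> path_gens n"
      using i less.prems by (auto simp: u_def v_def dest: in_set_takeD in_set_dropD)
    have split: "\<not> before x y" if "u = p @ [x]" "v = y # q" for p x y q
    proof -
      have "length p = i" using that(1) i(1) by (auto simp: u_def dest: arg_cong[of _ _ length])
      then have "w ! i = x" "w ! Suc i = y" using that by (simp_all add: w nth_append)
      then show ?thesis using i(2) by simp
    qed
    obtain f g :: "path_gen list \<Rightarrow> 'f" where "adapted n u f" "adapted n v g"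
      using less.hyps[OF len(1) X(1)] less.hyps[OF len(2) X(2)] by blast
    note f = adaptedD[OF this(1)] and g = adaptedD[OF this(2)]
    have fg: "(f \<star> g) (u' @ v') = f u' * g v'" if "length u' = length u" for u' v'
      using tprod_append[OF f(1) that] .
    have "f \<star> g \<in> tensor_power (path_gens n) (length w)"
      using tprod_tensor_power[OF f(1) g(1)] by (simp add: w)
    moreover have "(f \<star> g) w = 1"
      using fg[of u v] f(2) g(2) by (simp add: w)
    moreover have "w = w' \<or> key w < key w'" if "(f \<star> g) w' \<noteq> 0" for w'
    proof -
      have "w' \<in> supp (f \<star> g)" using that by (simp add: supp_def)
      then obtain u' v' where w': "w' = u' @ v'" "f u' \<noteq> 0" "g v' \<noteq> 0"
        using supp_tprod[of f g] by (auto simp: supp_def)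
      have "length u = length u'"
        using w'(2) tensor_power_eq_0[OF f(1)] by metis
      then show ?thesis
        unfolding w w'(1) using f(3)[OF w'(2)] g(3)[OF w'(3)] by (rule key_append_less)
    qed
    moreover have "dual_relations (f \<star> g) p' q'"
      if "w = p @ x # y # q" "before x y" and len: "length p' = length p" "length q' = length q"
      for p x y q p' q'
    proof -
      have "u @ v = p @ x # y # q" using that(1) by (simp only: w)
      then consider r where "u = p @ x # y # r" "q = r @ v" | "u = p @ [x]" "v = y # q"
        | r where "p = u @ r" "v = r @ x # y # q"
        by (auto simp: append_eq_append_conv2 append_eq_Cons_conv Cons_eq_append_conv)
      then show ?thesis
      proof cases
        \<comment> \<open>The pair lies inside \<open>u\<close>. The context to its right is cut
          where \<open>v\<close> begins, and the value of \<open>g\<close> on the far piece is the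
          constant factor.\<close>
        case 1
        define r' v' where "r' = take (length r) q'" and "v' = drop (length r) q'"
        have q': "q' = r' @ v'" and r': "length r' = length r"
          using len 1 by (simp_all add: r'_def v'_def)
        have "dual_relations f p' r'"
          using f(4)[OF 1(1) that(2) len(1) r'] .
        moreover have "(f \<star> g) (p' @ a # b # q') = g v' * f (p' @ a # b # r')" for a b
          using fg[of "p' @ a # b # r'" v'] 1 len r' by (simp add: q')
        ultimately show ?thesis by (rule dual_relations_mult)
      next
        case 2
        then show ?thesis using split that(2) by blast
      next
        \<comment> \<open>The mirror image: the pair lies inside \<open>v\<close>, and the value of
          \<open>f\<close> on the first piece is the constant factor.\<close>
        case 3
        define u' r' where "u' = take (length u) p'" and "r' = drop (length u) p'"
        have p': "p' = u' @ r'" and u': "length u' = length u" and r': "length r' = length r"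
          using len 3 by (simp_all add: r'_def u'_def)
        have "dual_relations g r' q'"
          using g(4)[OF 3(2) that(2) r' len(2)] .
        moreover have "(f \<star> g) (p' @ a # b # q') = f u' * g (r' @ a # b # q')" for a b
          using fg[OF u', of "r' @ a # b # q'"] by (simp add: p')
        ultimately show ?thesis by (rule dual_relations_mult)
      qed
    qed
    ultimately have "adapted n w (f \<star> g)"
      unfolding adapted_def by (intro conjI allI impI)
    then show ?thesis by blast
  qed
qed

section \<open>Koszulness from adapted tensors in each degree\<close>

theorem theorem4:
  fixes n :: nat
  assumes "n \<ge> 1"
  shows "koszul (path_algebra n :: (path_gen list \<Rightarrow> 'f::field) set ring)"
  unfolding path_algebra_def koszul_quadratic_algebra_iff[OF path_relations_quadratic]
proof
  fix m
  let ?X = "path_gens n" and ?R = "tensors.span (path_relations n) :: (path_gen list \<Rightarrow> 'f) set"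
  define W where "W = {w. set w \<subseteq> ?X \<and> length w = m}"
  have W: "finite W"
    unfolding W_def using finite_path_gens by (rule finite_lists_length_eq)
  have "\<exists>b :: path_gen list \<Rightarrow> 'f. adapted n w b" if "w \<in> W" for w
    using that by (intro ex_adapted) (simp add: W_def)
  then obtain b :: "path_gen list \<Rightarrow> path_gen list \<Rightarrow> 'f"
    where "\<And>w. w \<in> W \<Longrightarrow> adapted n w (b w)"
    by metis
  note b = adaptedD[OF this]
  show "generates_distributive_lattice (relation_subspaces ?X ?R m)"
  proof (rule generates_distributive_lattice_if_triangular[OF W b(2)])
    fix w w' assume "w \<in> W" "b w w' \<noteq> 0"
    then show "w' = w \<or> key w < key w'" using b(3) by blast
  next
    fix A assume "A \<in> relation_subspaces ?X ?R m"
    then obtain i where i: "i \<in> {1..m - 1}"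
      and "A = tensor (tensor (tensor_power ?X (i - 1)) ?R) (tensor_power ?X (m - i - 1))"
      by (auto simp: relation_subspaces_def)
    then have A: "A = relation_tensors n (i - 1) (m - i - 1)"
      by (simp only: relation_tensors_eq)
    \<comment> \<open>The bounds on \<open>i\<close> make the truncated subtractions exact:
      \<open>i - 1\<close> letters stand before the relation and \<open>m - i - 1\<close> after
      it.\<close>
    have m: "i - 1 + 2 + (m - i - 1) = m" using i by auto
    let ?U = "leading_words n (i - 1) (m - i - 1)"
    have U: "?U \<subseteq> W" using m by (auto simp: leading_words_def W_def)
    \<comment> \<open>Since \<open>w\<close> has an ordered pair at this position, adaptedness
      supplies the dual relations there in all contexts.\<close>
    moreover have "b w \<in> A" if w: "w \<in> ?U" for w
    proof -
      from w U have "w \<in> W" by blast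
      then have "b w \<in> tensor_power ?X m" using b(1)[of w] by (simp add: W_def)
      moreover have "dual_relations (b w) p' q'"
        if "length p' = i - 1" "length q' = m - i - 1" for p' q'
        using w that b(4)[OF \<open>w \<in> W\<close>] unfolding leading_words_def by auto
      ultimately show ?thesis unfolding A relation_tensors_def m by blast
    qed
    moreover have "f = 0" if "f \<in> A" "\<forall>w\<in>?U. f w = 0" for f
      using that relation_tensors_vanish unfolding A by blast
    ultimately show "tensors.subspace A \<and>
        (\<exists>U\<subseteq>W. b ` U \<subseteq> A \<and> (\<forall>f\<in>A. (\<forall>w\<in>U. f w = 0) \<longrightarrow> f = 0))"
      using subspace_relation_tensors A by (intro conjI exI[of _ ?U]) auto
  qed
qed

end
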